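(* Let $\alpha\in(0,1/2)$, let $f_1:\mathbb{Z}^3\to[0,\infty)$ be a function, and let $\xi_1=(1,0,0)$. Then there exist a function $\hat u_0:\mathbb{Z}^3\to\mathbb{C}^3$, a real solution $\hat u:\mathbb{Z}^3\times[0,\infty)\to\mathbb{C}^3$ of $$\partial_t\hat u(\xi,t)=-2\pi i\sum_{\substack{\zeta,\eta\in\mathbb{Z}^3\\ \zeta+\eta=\xi}}\bigl(\hat u(\zeta,t)\cdot\eta\bigr)\,\hat u(\eta,t),\qquad \hat u(\xi,t)\cdot\xi=0,\qquad \hat u(\xi,0)=\hat u_0(\xi)\qquad(\xi\in\mathbb{Z}^3,\ t\ge0),$$ and a time $T_0>0$ such that: (i) $|\hat u_0(\xi)|\le f_1(\xi)$ for all $\xi\in\mathbb{Z}^3$ with $|\xi|>1$; (ii) for every $\xi\in\mathbb{Z}^3$ the function $t\mapsto\hat u(\xi,t)$ is smooth ($C^\infty$) on $[0,\infty)$; (iii) $|\hat u(m\xi_1,T_0)|=|m\xi_1|^{-\alpha}$ for every $m\in\mathbb{Z}\setminus\{0\}$; (iv) for every $t>T_0$ and every $q>\frac{1}{2\alpha}$, the scaling exponent $D_q(t)$ of $\hat u$ in the direction $\xi_1$ exists and equals $$D_q(t)=(1-2\alpha)\,\frac{q}{q-1}.$$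
   Context: The system is the Fourier-side form of the incompressible Euler equations on $\mathbb{T}^3=\mathbb{R}^3/\mathbb{Z}^3$ with pressure constant in space, where $\hat u_j(\xi,t)=\int_{\mathbb{T}^3}u_j(x,t)e^{-2\pi i\xi\cdot x}\,dx$. A solution is understood purely on the Fourier side: it is a function $\hat u:\mathbb{Z}^3\times[0,\infty)\to\mathbb{C}^3$ satisfying the displayed equations for every $\xi\in\mathbb{Z}^3$ and $t\ge0$; no decay of $\hat u(\xi,t)$ in $\xi$ is required, but the series on the right-hand side must converge absolutely for every $\xi$ and $t$. For $a\in\mathbb{C}^3$ and $b\in\mathbb{Z}^3$, $a\cdot b=\sum_{j=1}^3a_jb_j$ (no conjugation), and $|\cdot|$ denotes the Euclidean (Hermitian) norm. A solution is real if $\hat u(-\xi,t)=\overline{\hat u(\xi,t)}$ for all $\xi,t$. The time derivative at $t=0$ is one-sided. Definition of $D_q(t)$. For $N>0$ let $u_N(x,t)=\sum_{|\xi|\le N}\hat u(\xi,t)e^{2\pi i\xi\cdot x}$ be the Fourier truncation, and let $U_N(x_1,t)=\int_{\mathbb{T}^2}u_N(x_1,x_2,x_3,t)\,dx_2\,dx_3$, whose Fourier coefficients on $\mathbb{T}^1=\mathbb{R}/\mathbb{Z}$ are $\hat U_N(m,t)=\hat u(m\xi_1,t)$ for $|m|\le N$ and $\hat U_N(m,t)=0$ for $|m|>N$, where $\xi_1=(1,0,0)$. Define the probability measure on $\mathbb{Z}$ $$\mu_N(m,t)=\frac{|\hat U_N(m,t)|^2}{\sum_{m'\in\mathbb{Z}}|\hat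 U_N(m',t)|^2},$$ (the denominator being required to be nonzero), the Renyi entropy $$H_{q,N}(t)=\frac{1}{1-q}\log\Bigl(\sum_{|m|\le N}\mu_N(m,t)^q\Bigr)\qquad(q>0,\ q\ne1),$$ and the scaling exponent $$D_q(t)=\lim_{N\to+\infty}\frac{H_{q,N}(t)}{\log N}.$$ *)

theory Defs
  imports "HOL-Analysis.Analysis"
begin

text \<open>
  Lattice points are elements of \<^typ>\<open>int^3\<close>, and the torus is represented by functions on
  \<^typ>\<open>real^3\<close> of period 1 in each coordinate, integrated over the unit cube. A family of Fourier
  coefficients has type \<^typ>\<open>int^3 \<Rightarrow> real \<Rightarrow> complex^3\<close>; only its values at times
  \<open>t \<ge> 0\<close> are meaningful.
\<close>

definition real_vec :: "int^3 \<Rightarrow> real^3" where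
  "real_vec \<xi> = (\<chi> j. real_of_int (\<xi> $ j))"

text \<open>\<^typ>\<open>int\<close> is not a normed space, hence a separate Euclidean norm on lattice points.\<close>

definition znorm :: "int^3 \<Rightarrow> real" where
  "znorm \<xi> = norm (real_vec \<xi>)"

text \<open>Bilinear, no conjugation.\<close>

definition zdot :: "complex^3 \<Rightarrow> int^3 \<Rightarrow> complex" where
  "zdot a b = (\<Sum>j\<in>UNIV. a $ j * of_int (b $ j))"

definition xi1 :: "int^3" where
  "xi1 = vector [1, 0, 0]"

subsection \<open>The Euler equations in Fourier variables\<close>

definition euler_term :: "(int^3 \<Rightarrow> real \<Rightarrow> complex^3) \<Rightarrow> real \<Rightarrow> (int^3) \<times> (int^3) \<Rightarrow> complex^3" where
  "euler_term u t = (\<lambda>(\<zeta>, \<eta>). zdot (u \<zeta> t) \<eta> *s u \<eta> t)"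

text \<open>
  The derivative within \<open>{0..}\<close> is two-sided for \<open>t > 0\<close> and one-sided at \<open>t = 0\<close>.
\<close>

definition euler_solution :: "(int^3 \<Rightarrow> complex^3) \<Rightarrow> (int^3 \<Rightarrow> real \<Rightarrow> complex^3) \<Rightarrow> bool" where
  "euler_solution u0 u \<longleftrightarrow>
     (\<forall>\<xi>. \<forall>t\<ge>0.
        (\<lambda>p. norm (euler_term u t p)) summable_on {(\<zeta>, \<eta>). \<zeta> + \<eta> = \<xi>} \<and>
        (u \<xi> has_vector_derivative
           (- 2 * of_real pi * \<i>) *s (\<Sum>\<^sub>\<infinity>p\<in>{(\<zeta>, \<eta>). \<zeta> + \<eta> = \<xi>}. euler_term u t p))
          (at t within {0..}) \<and>
        zdot (u \<xi> t) \<xi> = 0) \<and>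
     (\<forall>\<xi>. u \<xi> 0 = u0 \<xi>)"

definition real_solution :: "(int^3 \<Rightarrow> real \<Rightarrow> complex^3) \<Rightarrow> bool" where
  "real_solution u \<longleftrightarrow> (\<forall>\<xi>. \<forall>t\<ge>0. u (- \<xi>) t = (\<chi> j. cnj (u \<xi> t $ j)))"

subsection \<open>Smoothness\<close>

primrec Ck_on :: "nat \<Rightarrow> (real \<Rightarrow> 'a::real_normed_vector) \<Rightarrow> real set \<Rightarrow> bool" where
  "Ck_on 0 f S \<longleftrightarrow> continuous_on S f"
| "Ck_on (Suc k) f S \<longleftrightarrow>
     (\<exists>f'. (\<forall>t\<in>S. (f has_vector_derivative f' t) (at t within S)) \<and> Ck_on k f' S)"

definition smooth_on :: "(real \<Rightarrow> 'a::real_normed_vector) \<Rightarrow> real set \<Rightarrow> bool" where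
  "smooth_on f S \<longleftrightarrow> (\<forall>k. Ck_on k f S)"

subsection \<open>The scaling exponents in the direction \<open>\<xi>\<^sub>1\<close>\<close>

definition fourier_trunc :: "(int^3 \<Rightarrow> real \<Rightarrow> complex^3) \<Rightarrow> real \<Rightarrow> real \<Rightarrow> real^3 \<Rightarrow> complex^3" where
  "fourier_trunc u N t x =
     (\<Sum>\<xi> | znorm \<xi> \<le> N. exp (2 * of_real pi * \<i> * of_real (real_vec \<xi> \<bullet> x)) *s u \<xi> t)"

definition plane_mean :: "(int^3 \<Rightarrow> real \<Rightarrow> complex^3) \<Rightarrow> real \<Rightarrow> real \<Rightarrow> real \<Rightarrow> complex^3" where
  "plane_mean u N t x1 =
     integral (cbox (0, 0) (1, 1)) (\<lambda>(x2, x3). fourier_trunc u N t (vector [x1, x2, x3]))"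

definition plane_mean_coeff :: "(int^3 \<Rightarrow> real \<Rightarrow> complex^3) \<Rightarrow> real \<Rightarrow> int \<Rightarrow> real \<Rightarrow> complex^3" where
  "plane_mean_coeff u N m t =
     integral {0..1} (\<lambda>x1. exp (- 2 * of_real pi * \<i> * of_real (of_int m * x1)) *s plane_mean u N t x1)"

definition spectral_mass :: "(int^3 \<Rightarrow> real \<Rightarrow> complex^3) \<Rightarrow> real \<Rightarrow> real \<Rightarrow> real" where
  "spectral_mass u N t = (\<Sum>\<^sub>\<infinity>m\<in>UNIV. (norm (plane_mean_coeff u N m t))\<^sup>2)"

definition spectral_measure :: "(int^3 \<Rightarrow> real \<Rightarrow> complex^3) \<Rightarrow> real \<Rightarrow> int \<Rightarrow> real \<Rightarrow> real" where
  "spectral_measure u N m t = (norm (plane_mean_coeff u N m t))\<^sup>2 / spectral_mass u N t"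

definition renyi_entropy :: "(int^3 \<Rightarrow> real \<Rightarrow> complex^3) \<Rightarrow> real \<Rightarrow> real \<Rightarrow> real \<Rightarrow> real" where
  "renyi_entropy u q N t =
     1 / (1 - q) * ln (\<Sum>m | \<bar>real_of_int m\<bar> \<le> N. spectral_measure u N m t powr q)"

text \<open>
  The exponent exists and equals \<open>D\<close>. The cutoff \<open>N\<close> is a real number, and the normalising
  denominator has to be nonzero for all large \<open>N\<close>, i.e. along the limit.
\<close>

definition has_scaling_exponent :: "(int^3 \<Rightarrow> real \<Rightarrow> complex^3) \<Rightarrow> real \<Rightarrow> real \<Rightarrow> real \<Rightarrow> bool" where
  "has_scaling_exponent u q t D \<longleftrightarrow>
     0 < q \<and> q \<noteq> 1 \<and>
     (\<forall>\<^sub>F N in at_top. spectral_mass u N t \<noteq> 0) \<and>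
     ((\<lambda>N. renyi_entropy u q N t / ln N) \<longlongrightarrow> D) at_top"

subsection \<open>The Fourier coefficients of the plane means\<close>

lemma finite_znorm_le: "finite {\<xi>. znorm \<xi> \<le> N}"
proof -
  have "{\<xi>. znorm \<xi> \<le> N} \<subseteq> {\<xi>::int^3. \<forall>i. \<xi> $ i \<in> {-\<lceil>N\<rceil>..\<lceil>N\<rceil>}}"
  proof safe
    fix \<xi> :: "int^3" and i assume "znorm \<xi> \<le> N"
    moreover have "\<bar>real_of_int (\<xi> $ i)\<bar> \<le> znorm \<xi>"
      using component_le_norm_cart[of "real_vec \<xi>" i] by (simp add: znorm_def real_vec_def)
    ultimately have "\<bar>real_of_int (\<xi> $ i)\<bar> \<le> N" by linarith
    then show "\<xi> $ i \<in> {-\<lceil>N\<rceil>..\<lceil>N\<rceil>}" by (simp add: abs_le_iff) linarith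
  qed
  moreover have "finite {\<xi>::int^3. \<forall>i. \<xi> $ i \<in> {-\<lceil>N\<rceil>..\<lceil>N\<rceil>}}"
  proof -
    have "{\<xi>::int^3. \<forall>i. \<xi> $ i \<in> {-\<lceil>N\<rceil>..\<lceil>N\<rceil>}} \<subseteq> vec_lambda ` (PiE UNIV (\<lambda>_. {-\<lceil>N\<rceil>..\<lceil>N\<rceil>}))"
    proof
      fix \<xi> :: "int^3" assume "\<xi> \<in> {\<xi>. \<forall>i. \<xi> $ i \<in> {-\<lceil>N\<rceil>..\<lceil>N\<rceil>}}"
      then show "\<xi> \<in> vec_lambda ` (PiE UNIV (\<lambda>_. {-\<lceil>N\<rceil>..\<lceil>N\<rceil>}))"
        by (intro image_eqI[of _ _ "vec_nth \<xi>"]) auto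
    qed
    then show ?thesis by (rule finite_subset) (auto intro!: finite_PiE)
  qed
  ultimately show ?thesis by (rule finite_subset)
qed

definition char_int :: "int \<Rightarrow> real \<Rightarrow> complex" where
  "char_int k x = exp (2 * of_real pi * \<i> * of_real (of_int k * x))"

lemma continuous_on_char_int [continuous_intros]: "continuous_on S f \<Longrightarrow> continuous_on S (\<lambda>x. char_int k (f x))"
  unfolding char_int_def by (intro continuous_intros)

lemma integral_char_int: "integral {0..1} (char_int k) = (if k = 0 then 1 else 0)"
proof (cases "k = 0")
  case True
  then have "char_int k = (\<lambda>x. 1)" by (auto simp: char_int_def)
  with True show ?thesis by simp
next
  case False
  define c where "c = 2 * of_real pi * \<i> * (of_int k :: complex)"
  have c: "c \<noteq> 0" using False by (simp add: c_def)
  have eq: "char_int k = (\<lambda>x. exp (c * of_real x))" by (auto simp: char_int_def c_def mult_ac)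
  have "((\<lambda>x. exp (c * of_real x)) has_integral (exp (c * of_real 1) / c - exp (c * of_real 0) / c)) {0..1}"
    using c by (intro fundamental_theorem_of_calculus)
      (auto intro!: derivative_eq_intros has_vector_derivative_real_field)
  moreover have "exp c = 1" unfolding c_def exp_eq_1 by (auto intro!: exI[of _ k])
  ultimately show ?thesis using False eq by (simp add: integral_unique)
qed

lemma bounded_linear_smult: "bounded_linear (\<lambda>c::complex. c *s (v::complex^3))"
proof -
  have "linear (\<lambda>c::complex. c *s (v::complex^3))"
    by (rule linearI) (auto simp: vec_eq_iff algebra_simps)
  then show ?thesis by (simp add: linear_conv_bounded_linear)
qed

lemma integral_smult:
  fixes g :: "'a::euclidean_space \<Rightarrow> complex"
  assumes "g integrable_on S"
  shows "integral S (\<lambda>x. g x *s (v::complex^3)) = integral S g *s v" "(\<lambda>x. g x *s v) integrable_on S"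
  using integral_linear[OF assms bounded_linear_smult[of v]] integrable_linear[OF assms bounded_linear_smult[of v]] by (auto simp: o_def)

lemma exp_real_vec_inner: "exp (2 * of_real pi * \<i> * of_real (real_vec \<xi> \<bullet> vector [x1, x2, x3]))
   = char_int (\<xi>$1) x1 * (char_int (\<xi>$2) x2 * char_int (\<xi>$3) x3)"
  by (simp add: char_int_def real_vec_def inner_vec_def sum_3 exp_add[symmetric] algebra_simps)

lemma integral_char_int_plane: "integral (cbox (0,0) (1,1)) (\<lambda>(x2,x3). char_int a x1 * (char_int b x2 * char_int c x3)) =
   (if b = 0 \<and> c = 0 then char_int a x1 else 0)"
proof -
  have "continuous_on (cbox (0,0) (1::real,1::real)) (\<lambda>(x2,x3). char_int a x1 * (char_int b x2 * char_int c x3))"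
    unfolding case_prod_beta by (intro continuous_intros)
  from integral_prod_continuous[OF this] show ?thesis
    by (simp add: integral_char_int box_real)
qed

lemma plane_mean_eq: "plane_mean u N t x1 =
  (\<Sum>\<xi> | znorm \<xi> \<le> N. (if \<xi>$2 = 0 \<and> \<xi>$3 = 0 then char_int (\<xi>$1) x1 else 0) *s u \<xi> t)"
proof -
  have int: "(\<lambda>(x2,x3). char_int a x1 * (char_int b x2 * char_int c x3)) integrable_on cbox (0,0) (1,1)" for a b c
    unfolding case_prod_beta by (intro integrable_continuous continuous_intros)
  have "plane_mean u N t x1 = integral (cbox (0, 0) (1, 1)) (\<lambda>p.
     \<Sum>\<xi> | znorm \<xi> \<le> N. (\<lambda>(x2,x3). char_int (\<xi>$1) x1 * (char_int (\<xi>$2) x2 * char_int (\<xi>$3) x3)) p *s u \<xi> t)"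
    unfolding plane_mean_def fourier_trunc_def exp_real_vec_inner by (simp add: case_prod_unfold)
  also have "\<dots> = (\<Sum>\<xi> | znorm \<xi> \<le> N. integral (cbox (0, 0) (1, 1)) (\<lambda>p.
      (\<lambda>(x2,x3). char_int (\<xi>$1) x1 * (char_int (\<xi>$2) x2 * char_int (\<xi>$3) x3)) p *s u \<xi> t))"
    by (intro integral_sum finite_znorm_le integral_smult int)
  also have "\<dots> = (\<Sum>\<xi> | znorm \<xi> \<le> N. (if \<xi>$2 = 0 \<and> \<xi>$3 = 0 then char_int (\<xi>$1) x1 else 0) *s u \<xi> t)"
    by (simp only: integral_smult(1)[OF int] integral_char_int_plane)
  finally show ?thesis .
qed

lemma plane_mean_coeff_eq:
  "plane_mean_coeff u N m t = (if \<bar>real_of_int m\<bar> \<le> N then u (m *s xi1) t else 0)"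
proof -
  have e: "exp (- 2 * of_real pi * \<i> * of_real (of_int m * x)) = char_int (-m) x" for x
    by (simp add: char_int_def)
  have m: "char_int (-m) x * char_int k x = char_int (k - m) x" for k x
    by (simp add: char_int_def exp_add[symmetric] algebra_simps)
  have iff: "(\<xi>$2 = 0 \<and> \<xi>$3 = 0 \<and> \<xi>$1 = m) \<longleftrightarrow> \<xi> = m *s xi1" for \<xi> :: "int^3"
    by (auto simp: vec_eq_iff forall_3 xi1_def)
  let ?g = "\<lambda>\<xi>::int^3. \<lambda>x. if \<xi>$2 = 0 \<and> \<xi>$3 = 0 then char_int (\<xi>$1 - m) x else 0"
  have int: "?g \<xi> integrable_on {0..1}" for \<xi>
    by (cases "\<xi>$2 = 0 \<and> \<xi>$3 = 0") (auto intro!: integrable_continuous_interval continuous_intros)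
  have "plane_mean_coeff u N m t = integral {0..1} (\<lambda>x. \<Sum>\<xi> | znorm \<xi> \<le> N. ?g \<xi> x *s u \<xi> t)"
    unfolding plane_mean_coeff_def plane_mean_eq e
    by (intro integral_cong) (auto simp: vec_eq_iff sum_distrib_left m[symmetric] mult_ac intro!: sum.cong)
  also have "\<dots> = (\<Sum>\<xi> | znorm \<xi> \<le> N. integral {0..1} (?g \<xi>) *s u \<xi> t)"
    by (subst integral_sum) (auto simp: finite_znorm_le integral_smult int)
  also have "\<dots> = (\<Sum>\<xi> | znorm \<xi> \<le> N. if \<xi> = m *s xi1 then u \<xi> t else 0)"
  proof (intro sum.cong refl)
    fix \<xi> :: "int^3"
    have "integral {0..1} (?g \<xi>) = (if \<xi> = m *s xi1 then 1 else 0)"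
      unfolding iff[symmetric]
      by (cases "\<xi>$2 = 0 \<and> \<xi>$3 = 0") (use integral_char_int[of "\<xi>$1 - m"] in auto)
    then show "integral {0..1} (?g \<xi>) *s u \<xi> t = (if \<xi> = m *s xi1 then u \<xi> t else 0)" by simp
  qed
  also have "\<dots> = (if znorm (m *s xi1) \<le> N then u (m *s xi1) t else 0)"
    by (simp add: sum.delta' finite_znorm_le)
  also have "znorm (m *s xi1) = \<bar>real_of_int m\<bar>"
    by (simp add: znorm_def real_vec_def xi1_def norm_vec_def L2_set_def sum_3)
  finally show ?thesis .
qed

end

theory Submission
  imports Defs "HOL-Computational_Algebra.Polynomial"
begin

text \<open>
  With constant pressure the Euler equations admit the shear flows
  \<open>u = (V(x\<^sub>3), w(x\<^sub>1, x\<^sub>3, t), 0)\<close>: such a field is divergence free, and the system reduces to the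
  linear transport equation \<open>\<partial>\<^sub>t w + V(x\<^sub>3) \<partial>\<^sub>1 w = 0\<close>. For \<open>V(x\<^sub>3) = cos(2 \<pi> x\<^sub>3) / \<pi>\<close>, which excites
  only the lattice points \<open>(0, 0, \<plusminus>1)\<close>, the Fourier coefficients \<open>w(m, n, t)\<close> of \<open>w\<close> satisfy
  \<open>\<partial>\<^sub>t w(m, n) = - \<i> m (w(m, n - 1) + w(m, n + 1))\<close>.
  For each \<open>m \<noteq> 0\<close> this is a ladder of ordinary differential equations in \<open>n\<close>, and since no decay in \<open>n\<close>
  is demanded it is underdetermined, as in Tychonoff's example for the heat equation:
  the function \<open>w(m, 0, \<cdot>)\<close> may be prescribed freely, and together with the symmetry
  \<open>w(m, -n) = w(m, n)\<close> the ladder then determines every other rung by differentiation.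

  The choice \<open>w(m, 0, t) = \<bar>m\<bar>\<^sup>-\<^sup>\<alpha> exp (1 - 1/t)\<close> is flat at \<open>t = 0\<close>, so all of \<open>w\<close> vanishes initially
  and the initial datum is \<open>V\<close> alone, which lives on \<open>\<bar>\<xi>\<bar> = 1\<close>. Hence any bound \<open>f1\<close> is respected.
  At \<open>T0 = 1\<close> the modes on the axis have the required modulus, and at later times they are a
  common positive multiple of \<open>\<bar>m\<bar>\<^sup>-\<^sup>\<alpha>\<close>. The lemma \<open>cascade_flow_solves_euler\<close> verifies the equations.

  A common factor cancels in the spectral measure, so the entropy depends only on the sums
  \<open>S(s, N) = \<Sum>\<bar>m\<bar>\<^sup>-\<^sup>s\<close> over \<open>0 < \<bar>m\<bar> \<le> N\<close>: it is
  \<open>(ln S(2 \<alpha> q, N) - q ln S(2 \<alpha>, N)) / (1 - q)\<close>. As \<open>2 \<alpha> < 1 < 2 \<alpha> q\<close>, the first sum stays bounded and the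
  second grows like \<open>N\<close> to the power \<open>1 - 2 \<alpha>\<close>, which gives the exponent
  (\<open>scaling_exponent_power_law\<close>).
\<close>

section \<open>Polynomial multiples of the flat function\<close>

text \<open>
  The functions \<open>p(1/t) exp (1 - 1/t)\<close>, continued by 0, form a space that contains the flat
  function and is closed under differentiation; \<open>flat_deriv\<close> is the derivative transported to the
  polynomials \<open>p\<close>. This turns repeated differentiation into algebra. The normalisation
  makes \<open>flat 1\<close> equal to 1 at time 1.
\<close>

definition flat :: "real poly \<Rightarrow> real \<Rightarrow> real" where
  "flat p t = (if t \<le> 0 then 0 else poly p (1 / t) * exp (1 - 1 / t))"

definition flat_deriv :: "real poly \<Rightarrow> real poly" where
  "flat_deriv p = [:0, 0, 1:] * (p - pderiv p)"

lemma flat_0 [simp]: "flat p 0 = 0"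
  by (simp add: flat_def)

lemma flat_add: "flat (p + q) t = flat p t + flat q t"
  by (simp add: flat_def algebra_simps)

lemma flat_smult: "flat (smult c p) t = c * flat p t"
  by (simp add: flat_def)

lemma poly_mult_exp_minus_tendsto_0:
  "((\<lambda>x::real. poly p x * exp (- x)) \<longlongrightarrow> 0) at_top"
proof -
  have "((\<lambda>x. \<Sum>i\<le>degree p. coeff p i * (x ^ i / exp x)) \<longlongrightarrow> (\<Sum>i\<le>degree p. coeff p i * 0)) at_top"
    by (intro tendsto_sum tendsto_mult tendsto_const tendsto_power_div_exp_0)
  then show ?thesis
    by (simp add: poly_altdef exp_minus sum_distrib_right divide_inverse mult.assoc)
qed

text \<open>
  Substituting \<open>s = 1/t\<close> turns the difference quotient at 0 into a polynomial times \<open>exp (-s)\<close>.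
\<close>

lemma flat_quotient_tendsto_0: "((\<lambda>t. flat p t / t) \<longlongrightarrow> 0) (at_right 0)"
proof -
  have "((\<lambda>s. exp 1 * (poly (pCons 0 p) s * exp (- s))) \<longlongrightarrow> exp 1 * 0) at_top"
    by (intro tendsto_mult tendsto_const poly_mult_exp_minus_tendsto_0)
  then have "((\<lambda>t. exp 1 * (poly (pCons 0 p) (inverse t) * exp (- inverse t))) \<longlongrightarrow> exp 1 * 0) (at_right 0)"
    by (rule filterlim_compose[OF _ filterlim_inverse_at_top_right])
  moreover have "\<forall>\<^sub>F t in at_right 0.
      exp 1 * (poly (pCons 0 p) (inverse t) * exp (- inverse t)) = flat p t / t"
    by (auto simp: eventually_at_filter flat_def exp_diff exp_minus inverse_eq_divide mult_ac intro!: always_eventually)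
  ultimately show ?thesis
    using Lim_transform_eventually by fastforce
qed

lemma flat_has_derivative:
  assumes "t \<ge> 0"
  shows "(flat p has_real_derivative flat (flat_deriv p) t) (at t within {0..})"
proof (cases "t = 0")
  case True
  have "at (0::real) within {0..} = at_right 0"
    unfolding at_within_def by (intro arg_cong[where f = "\<lambda>A. inf (nhds 0) (principal A)"]) auto
  then show ?thesis
    using flat_quotient_tendsto_0[of p] True by (simp add: has_field_derivative_iff)
next
  case False
  with assms have t: "t > 0" by simp
  have "((\<lambda>t. poly p (1 / t) * exp (1 - 1 / t)) has_real_derivative flat (flat_deriv p) t) (at t)"
    using t by (auto intro!: derivative_eq_intros DERIV_chain2[OF poly_DERIV]
        simp: flat_def flat_deriv_def field_simps power2_eq_square)
  then have "(flat p has_real_derivative flat (flat_deriv p) t) (at t)"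
    by (rule has_field_derivative_transform_within_open[of _ _ _ "{0<..}"]) (use t in \<open>auto simp: flat_def\<close>)
  then show ?thesis by (rule DERIV_subset) simp
qed

lemma affine_flat_has_vector_derivative:
  assumes "t \<ge> 0"
  shows "((\<lambda>t. v + flat p t *\<^sub>R w) has_vector_derivative flat (flat_deriv p) t *\<^sub>R w) (at t within {0..})"
  using flat_has_derivative[OF assms, of p]
  by (auto intro!: derivative_eq_intros)

lemma smooth_on_affine_flat: "smooth_on (\<lambda>t. v + flat p t *\<^sub>R w) {0..}"
proof -
  have "Ck_on k (\<lambda>t. v + flat p t *\<^sub>R w) {0..}" for k
  proof (induction k arbitrary: v p)
    case 0
    show ?case
      by (auto simp: continuous_on_eq_continuous_within
          intro!: has_vector_derivative_continuous affine_flat_has_vector_derivative)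
  next
    case (Suc k)
    show ?case
      using affine_flat_has_vector_derivative[of _ v p w] Suc[of 0 "flat_deriv p"]
      by (auto intro!: exI[of _ "\<lambda>t. flat (flat_deriv p) t *\<^sub>R w"])
  qed
  then show ?thesis by (simp add: smooth_on_def)
qed

section \<open>The cascade solution\<close>

text \<open>
  Writing \<open>w(m, n, t) = \<bar>m\<bar>\<^sup>-\<^sup>\<alpha> (\<i>/m)\<^sup>k g\<^sub>k(t)\<close> with \<open>k = \<bar>n\<bar>\<close> makes the ladder real:
  \<open>g\<^sub>k\<^sub>+\<^sub>2 = g\<^sub>k\<^sub>+\<^sub>1' + m\<^sup>2 g\<^sub>k\<close>. At \<open>n = 0\<close> both neighbours are equal, whence the factor 1/2 in \<open>g\<^sub>1\<close>.
  The polynomial \<open>cascade c k\<close> represents \<open>g\<^sub>k\<close> through \<open>flat\<close>, where \<open>c = m\<^sup>2\<close>.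
\<close>

fun cascade :: "real \<Rightarrow> nat \<Rightarrow> real poly" where
  "cascade c 0 = 1"
| "cascade c (Suc 0) = smult (1 / 2) (flat_deriv 1)"
| "cascade c (Suc (Suc k)) = flat_deriv (cascade c (Suc k)) + smult c (cascade c k)"

definition e3 :: "int^3" where
  "e3 = axis 3 1"

text \<open>
  The Fourier coefficients of the steady shear \<open>cos(2 \<pi> x\<^sub>3) / \<pi>\<close>; the amplitude cancels the
  factor \<open>2 \<pi>\<close> of the equation.
\<close>

definition background :: "int^3 \<Rightarrow> complex^3" where
  "background \<xi> = (if \<xi> = e3 \<or> \<xi> = - e3 then axis 1 (1 / (2 * of_real pi)) else 0)"

text \<open>
  For \<open>\<xi> $ 1 = 0\<close> the value is 0, because \<open>0 powr (- \<alpha>) = 0\<close>: the component \<open>w\<close> has no \<open>x\<^sub>1\<close>-mean.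
\<close>

definition phase :: "real \<Rightarrow> int^3 \<Rightarrow> complex" where
  "phase \<alpha> \<xi> = (if \<xi> $ 2 = 0
     then of_real (\<bar>of_int (\<xi> $ 1)\<bar> powr (- \<alpha>)) * (\<i> / of_int (\<xi> $ 1)) ^ nat \<bar>\<xi> $ 3\<bar> else 0)"

definition cascade_flow :: "real \<Rightarrow> int^3 \<Rightarrow> real \<Rightarrow> complex^3" where
  "cascade_flow \<alpha> \<xi> t = background \<xi> +
     flat (cascade ((of_int (\<xi> $ 1))\<^sup>2) (nat \<bar>\<xi> $ 3\<bar>)) t *\<^sub>R axis 2 (phase \<alpha> \<xi>)"

lemma e3_nth [simp]: "e3 $ 1 = 0" "e3 $ 2 = 0" "e3 $ 3 = 1"
  by (simp_all add: e3_def axis_def)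

lemma e3_neq_uminus: "e3 \<noteq> - e3"
  by (simp add: vec_eq_iff forall_3)

lemma cascade_flow_nth:
  "cascade_flow \<alpha> \<xi> t $ 1 = (if \<xi> = e3 \<or> \<xi> = - e3 then 1 / (2 * of_real pi) else 0)"
  "cascade_flow \<alpha> \<xi> t $ 2 =
     of_real (flat (cascade ((of_int (\<xi> $ 1))\<^sup>2) (nat \<bar>\<xi> $ 3\<bar>)) t) * phase \<alpha> \<xi>"
  "cascade_flow \<alpha> \<xi> t $ 3 = 0"
  by (auto simp: cascade_flow_def background_def axis_def scaleR_conv_of_real[where 'a = complex])

lemma phase_eq_0 [simp]: "\<xi> $ 2 \<noteq> 0 \<Longrightarrow> phase \<alpha> \<xi> = 0" "\<xi> $ 1 = 0 \<Longrightarrow> phase \<alpha> \<xi> = 0"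
  by (simp_all add: phase_def)

lemma cascade_flow_divergence_free: "zdot (cascade_flow \<alpha> \<xi> t) \<xi> = 0"
  by (auto simp: zdot_def sum_3 cascade_flow_nth phase_def)

lemma cascade_flow_real: "real_solution (cascade_flow \<alpha>)"
proof -
  have "phase \<alpha> (- \<xi>) = cnj (phase \<alpha> \<xi>)" for \<xi>
    by (simp add: phase_def)
  moreover have minus_eq: "- \<xi> = e3 \<longleftrightarrow> \<xi> = - e3" for \<xi> :: "int^3"
    by (metis minus_minus)
  ultimately show ?thesis
    unfolding real_solution_def vec_eq_iff[of "cascade_flow _ _ _"] forall_3
    by (auto simp: cascade_flow_nth minus_eq)
qed

lemma cascade_flow_nonzero_imp:
  assumes "cascade_flow \<alpha> \<eta> t \<noteq> 0"
  shows "\<eta> $ 2 = 0"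
proof (rule ccontr)
  assume "\<eta> $ 2 \<noteq> 0"
  moreover from this have "\<eta> \<noteq> e3" "\<eta> \<noteq> - e3" by auto
  ultimately show False
    using assms by (simp add: cascade_flow_def background_def)
qed

text \<open>
  Every mode that is present has \<open>\<eta> $ 2 = 0\<close>, so the second component of \<open>\<zeta>\<close>'s mode never
  contributes to \<open>u(\<zeta>) \<cdot> \<eta>\<close>: only the background transports, and \<open>w\<close> enters linearly.
\<close>

lemma euler_term_cascade_flow:
  "euler_term (cascade_flow \<alpha>) t (\<zeta>, \<eta>) =
     (if \<zeta> = e3 \<or> \<zeta> = - e3 then of_int (\<eta> $ 1) / (2 * of_real pi) else 0) *s cascade_flow \<alpha> \<eta> t"
proof (cases "cascade_flow \<alpha> \<eta> t = 0")
  case False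
  then have "\<eta> $ 2 = 0" by (rule cascade_flow_nonzero_imp)
  then show ?thesis
    by (simp add: euler_term_def zdot_def sum_3 cascade_flow_nth)
qed (simp add: euler_term_def)

text \<open>
  The convolution has just the two terms \<open>\<zeta> = \<plusminus>e3\<close>, so its absolute convergence is automatic
  however fast the coefficients grow in \<open>\<xi> $ 3\<close>.
\<close>

lemma cascade_flow_interactions:
  fixes \<xi> :: "int^3"
  defines "A \<equiv> {(\<zeta>, \<eta>). \<zeta> + \<eta> = \<xi>}"
  shows "(\<lambda>p. norm (euler_term (cascade_flow \<alpha>) t p)) summable_on A"
    and "(\<Sum>\<^sub>\<infinity>p\<in>A. euler_term (cascade_flow \<alpha>) t p) =
      (of_int (\<xi> $ 1) / (2 * of_real pi)) *s (cascade_flow \<alpha> (\<xi> - e3) t + cascade_flow \<alpha> (\<xi> + e3) t)"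
proof -
  define B where "B = {(e3, \<xi> - e3), (- e3, \<xi> + e3)}"
  have zero: "euler_term (cascade_flow \<alpha>) t p = 0" if "p \<in> A - B" for p
    using that by (cases p) (auto simp: A_def B_def euler_term_cascade_flow)
  have sub: "B \<subseteq> A" "finite B" by (auto simp: A_def B_def)
  have "(\<lambda>p. norm (euler_term (cascade_flow \<alpha>) t p)) summable_on B"
    using sub by (intro summable_on_finite)
  then show "(\<lambda>p. norm (euler_term (cascade_flow \<alpha>) t p)) summable_on A"
    by (rule summable_on_cong_neutral[THEN iffD1, rotated -1]) (use zero sub in auto)
  have "(\<Sum>\<^sub>\<infinity>p\<in>A. euler_term (cascade_flow \<alpha>) t p) = (\<Sum>\<^sub>\<infinity>p\<in>B. euler_term (cascade_flow \<alpha>) t p)"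
    by (rule infsum_cong_neutral) (use zero sub in auto)
  also have "\<dots> = (\<Sum>p\<in>B. euler_term (cascade_flow \<alpha>) t p)"
    using sub by simp
  finally show "(\<Sum>\<^sub>\<infinity>p\<in>A. euler_term (cascade_flow \<alpha>) t p) =
      (of_int (\<xi> $ 1) / (2 * of_real pi)) *s (cascade_flow \<alpha> (\<xi> - e3) t + cascade_flow \<alpha> (\<xi> + e3) t)"
    using e3_neq_uminus by (simp add: B_def euler_term_cascade_flow vector_add_ldistrib)
qed

text \<open>
  The ladder equation for \<open>w\<close>, up to the common factor \<open>\<bar>m\<bar>\<^sup>-\<^sup>\<alpha>\<close>: it is the recursion of \<open>cascade\<close>
  multiplied by \<open>(\<i>/m)\<^sup>k\<close>, read in both directions of \<open>n\<close>.
\<close>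

lemma cascade_ladder:
  fixes m n :: int and t :: real
  defines "v \<equiv> \<lambda>n. (\<i> / of_int m) ^ nat \<bar>n\<bar> * of_real (flat (cascade ((of_int m)\<^sup>2) (nat \<bar>n\<bar>)) t)"
  assumes "m \<noteq> 0"
  shows "(\<i> / of_int m) ^ nat \<bar>n\<bar> * of_real (flat (flat_deriv (cascade ((of_int m)\<^sup>2) (nat \<bar>n\<bar>))) t)
    = - \<i> * of_int m * (v (n - 1) + v (n + 1))"
proof -
  define z where "z k = (\<i> / of_int m) ^ k * complex_of_real (flat (cascade ((of_int m)\<^sup>2) k) t)" for k
  have neighbours: "v (n - 1) + v (n + 1) =
      (case nat \<bar>n\<bar> of 0 \<Rightarrow> 2 * z 1 | Suc k \<Rightarrow> z k + z (Suc (Suc k)))"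
  proof (cases "n = 0")
    case False
    then consider k where "n = int (Suc k)" | k where "n = - int (Suc k)"
      by (metis int_cases nat.exhaust of_nat_0 negative_zle int_cases2)
    then show ?thesis
    proof cases
      case 1
      then have "nat \<bar>n\<bar> = Suc k" "nat \<bar>n - 1\<bar> = k" "nat \<bar>n + 1\<bar> = Suc (Suc k)" by auto
      then show ?thesis by (simp add: v_def z_def)
    next
      case 2
      then have "nat \<bar>n\<bar> = Suc k" "nat \<bar>n + 1\<bar> = k" "nat \<bar>n - 1\<bar> = Suc (Suc k)" by auto
      then show ?thesis by (simp add: v_def z_def)
    qed
  qed (simp add: v_def z_def)
  show ?thesis
  proof (cases "nat \<bar>n\<bar>")
    case 0
    then show ?thesis
      using \<open>m \<noteq> 0\<close> unfolding neighbours by (simp add: z_def flat_smult)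
  next
    case (Suc k)
    then show ?thesis
      using \<open>m \<noteq> 0\<close> unfolding neighbours
      by (simp add: z_def flat_add flat_smult field_simps power2_eq_square)
  qed
qed

lemma cascade_flow_solves_euler: "euler_solution background (cascade_flow \<alpha>)"
proof -
  have eq: "flat (flat_deriv (cascade ((of_int (\<xi> $ 1))\<^sup>2) (nat \<bar>\<xi> $ 3\<bar>))) t *\<^sub>R axis 2 (phase \<alpha> \<xi>) =
      (- 2 * of_real pi * \<i>) *s ((of_int (\<xi> $ 1) / (2 * of_real pi)) *s
        (cascade_flow \<alpha> (\<xi> - e3) t + cascade_flow \<alpha> (\<xi> + e3) t))" for \<xi> t
  proof (cases "\<xi> $ 1 = 0")
    case False
    \<comment> \<open>Off the plane \<open>\<xi> $ 1 = 0\<close> the background vanishes at both neighbours, so they carry only \<open>w\<close>.\<close>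
    have "v \<noteq> e3" "v \<noteq> - e3" if "v $ 1 \<noteq> 0" for v :: "int^3"
      using that by auto
    from this[of "\<xi> - e3"] this[of "\<xi> + e3"] False
    have off: "\<xi> - e3 \<noteq> e3" "\<xi> - e3 \<noteq> - e3" "\<xi> + e3 \<noteq> e3" "\<xi> + e3 \<noteq> - e3"
      by simp_all
    have "complex_of_real (flat (flat_deriv (cascade ((of_int (\<xi> $ 1))\<^sup>2) (nat \<bar>\<xi> $ 3\<bar>))) t) * phase \<alpha> \<xi> =
        - \<i> * of_int (\<xi> $ 1) * (cascade_flow \<alpha> (\<xi> - e3) t $ 2 + cascade_flow \<alpha> (\<xi> + e3) t $ 2)"
    proof (cases "\<xi> $ 2 = 0")
      case True
      then show ?thesis
        using arg_cong[where f = "\<lambda>z. complex_of_real (\<bar>of_int (\<xi> $ 1)\<bar> powr (- \<alpha>)) * z",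
            OF cascade_ladder[OF False, of "\<xi> $ 3" t]]
        by (simp add: cascade_flow_nth phase_def algebra_simps)
    qed (simp add: cascade_flow_nth)
    then show ?thesis
      by (simp add: vec_eq_iff forall_3 cascade_flow_nth(1,3) off axis_def
          scaleR_conv_of_real[where 'a = complex] ring_distribs)
  qed (simp add: vec_eq_iff axis_def)
  have "(cascade_flow \<alpha> \<xi> has_vector_derivative
      flat (flat_deriv (cascade ((of_int (\<xi> $ 1))\<^sup>2) (nat \<bar>\<xi> $ 3\<bar>))) t *\<^sub>R axis 2 (phase \<alpha> \<xi>))
      (at t within {0..})" if "t \<ge> 0" for \<xi> t
    unfolding cascade_flow_def[abs_def] using that by (rule affine_flat_has_vector_derivative)
  moreover have "cascade_flow \<alpha> \<xi> 0 = background \<xi>" for \<xi>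
    by (simp add: cascade_flow_def)
  ultimately show ?thesis
    unfolding euler_solution_def cascade_flow_interactions(2)
    by (auto simp only: eq cascade_flow_interactions(1) cascade_flow_divergence_free)
qed

lemma norm_axis_complex: "norm (axis i c :: complex^3) = norm c"
  by (simp add: norm_vec_def L2_set_def axis_def if_distrib[of norm] if_distrib[of "\<lambda>x. x\<^sup>2"] cong: if_cong)

lemma norm_cascade_flow_axis:
  "norm (cascade_flow \<alpha> (m *s xi1) t) = flat 1 t * \<bar>of_int m\<bar> powr (- \<alpha>)"
proof -
  have "m *s xi1 \<noteq> e3" "m *s xi1 \<noteq> - e3"
    by (auto simp: vec_eq_iff forall_3 xi1_def)
  then show ?thesis
    by (simp add: cascade_flow_def background_def phase_def xi1_def norm_axis_complex flat_def)
qed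

lemma znorm_axis: "znorm (m *s xi1) = \<bar>real_of_int m\<bar>"
  by (simp add: znorm_def real_vec_def xi1_def norm_vec_def L2_set_def sum_3)

lemma znorm_e3: "znorm e3 = 1" "znorm (- e3) = 1"
  by (simp_all add: znorm_def real_vec_def norm_vec_def L2_set_def sum_3)

section \<open>Growth of power sums\<close>

text \<open>
  The index set is the one of the entropy; its element \<open>m = 0\<close> contributes \<open>0 powr (- s) = 0\<close>.
\<close>

definition power_sum :: "real \<Rightarrow> real \<Rightarrow> real" where
  "power_sum s N = (\<Sum>m | \<bar>real_of_int m\<bar> \<le> N. \<bar>of_int m\<bar> powr (- s))"

lemma abs_le_interval: "{m::int. \<bar>real_of_int m\<bar> \<le> N} = {- \<lfloor>N\<rfloor>..\<lfloor>N\<rfloor>}"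
  by (auto simp: le_floor_iff abs_le_iff; linarith)

lemma power_sum_eq:
  assumes "N \<ge> 0"
  shows "power_sum s N = 2 * (\<Sum>k=1..nat \<lfloor>N\<rfloor>. real k powr (- s))"
proof -
  have "(\<Sum>m = - int n..int n. \<bar>real_of_int m\<bar> powr (- s)) = 2 * (\<Sum>k=1..n. real k powr (- s))" for n
  proof (induction n)
    case (Suc n)
    have "{- int (Suc n)..int (Suc n)} = insert (int (Suc n)) (insert (- int (Suc n)) {- int n..int n})"
      by auto
    then show ?case using Suc by (simp add: add.commute)
  qed simp
  from this[of "nat \<lfloor>N\<rfloor>"] show ?thesis
    using assms by (simp add: power_sum_def abs_le_interval)
qed

text \<open>
  By the mean value theorem \<open>(n + 1)\<^sup>-\<^sup>s\<close> is at most the increment of \<open>x\<^sup>1\<^sup>-\<^sup>s / (1 - s)\<close> over \<open>[n, n + 1]\<close>,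
  and these increments telescope.
\<close>

lemma power_sum_upper_subcritical:
  assumes "0 < s" "s < 1" "N \<ge> 1"
  shows "power_sum s N \<le> 2 / (1 - s) * N powr (1 - s)"
proof -
  have *: "(\<Sum>k=1..n. real k powr (- s)) \<le> real n powr (1 - s) / (1 - s)" if "n \<ge> 1" for n
    using that
  proof (induction n rule: dec_induct)
    case base
    show ?case using assms by (simp add: field_simps)
  next
    case (step n)
    have "\<exists>x. real n < x \<and> x < real (Suc n) \<and>
        real (Suc n) powr (1 - s) - real n powr (1 - s) = (real (Suc n) - real n) * ((1 - s) * x powr (- s))"
      using step assms
      by (intro MVT2) (auto intro!: derivative_eq_intros has_real_derivative_powr)
    then obtain x where x: "real n < x" "x < real (Suc n)"
      "real (Suc n) powr (1 - s) - real n powr (1 - s) = (1 - s) * x powr (- s)"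
      by auto
    have "real (Suc n) powr (- s) \<le> x powr (- s)"
      using x step assms by (intro powr_mono2') auto
    also have "\<dots> = real (Suc n) powr (1 - s) / (1 - s) - real n powr (1 - s) / (1 - s)"
      using x(3) assms by (simp add: diff_divide_distrib[symmetric])
    finally show ?case using step.IH by simp
  qed
  have "nat \<lfloor>N\<rfloor> \<ge> 1" using assms by (simp add: le_nat_iff)
  from *[OF this] have "power_sum s N \<le> 2 * (real (nat \<lfloor>N\<rfloor>) powr (1 - s) / (1 - s))"
    using assms by (simp add: power_sum_eq)
  also have "\<dots> \<le> 2 * (N powr (1 - s) / (1 - s))"
    using assms by (intro mult_left_mono divide_right_mono powr_mono2) auto
  finally show ?thesis by simp
qed

text \<open>
  Each of the \<open>2 \<lfloor>N\<rfloor> \<ge> N\<close> nonzero terms is at least \<open>N\<^sup>-\<^sup>s\<close>.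
\<close>

lemma power_sum_lower:
  assumes "0 < s" "N \<ge> 1"
  shows "N powr (1 - s) \<le> power_sum s N"
proof -
  have "\<lfloor>N\<rfloor> \<ge> 1" using assms by (simp add: le_floor_iff)
  then have "N \<le> 2 * real (nat \<lfloor>N\<rfloor>)" by linarith
  have "N powr (1 - s) = N * N powr (- s)"
    using assms by (simp add: powr_diff powr_minus divide_inverse)
  also have "\<dots> \<le> (2 * real (nat \<lfloor>N\<rfloor>)) * N powr (- s)"
    using \<open>N \<le> 2 * real (nat \<lfloor>N\<rfloor>)\<close> by (intro mult_right_mono powr_ge_zero)
  also have "\<dots> = 2 * (\<Sum>k=1..nat \<lfloor>N\<rfloor>. N powr (- s))"
    by simp
  also have "\<dots> \<le> 2 * (\<Sum>k=1..nat \<lfloor>N\<rfloor>. real k powr (- s))"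
    using assms by (intro mult_left_mono sum_mono powr_mono2') (auto simp: le_nat_iff le_floor_iff)
  finally show ?thesis
    using assms by (simp add: power_sum_eq)
qed

lemma power_sum_bounds_supercritical:
  assumes "s > 1" "N \<ge> 1"
  shows "1 \<le> power_sum s N" "power_sum s N \<le> 2 * (\<Sum>k. real k powr (- s))"
proof -
  have sm: "summable (\<lambda>k. real k powr (- s))"
    using assms by (simp add: summable_real_powr_iff)
  have "nat \<lfloor>N\<rfloor> \<ge> 1" using assms by (simp add: le_nat_iff)
  then have "(\<Sum>k\<in>{1}. real k powr (- s)) \<le> (\<Sum>k=1..nat \<lfloor>N\<rfloor>. real k powr (- s))"
    by (intro sum_mono2) auto
  then show "1 \<le> power_sum s N"
    using assms by (simp add: power_sum_eq)
  have "(\<Sum>k=1..nat \<lfloor>N\<rfloor>. real k powr (- s)) \<le> (\<Sum>k. real k powr (- s))"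
    by (intro sum_le_suminf sm) auto
  then show "power_sum s N \<le> 2 * (\<Sum>k. real k powr (- s))"
    using assms by (simp add: power_sum_eq)
qed

lemma growth_exponent:
  fixes g :: "real \<Rightarrow> real"
  assumes "a > 0" and "\<forall>\<^sub>F N in at_top. a * N powr r \<le> g N" and "\<forall>\<^sub>F N in at_top. g N \<le> b * N powr r"
  shows "((\<lambda>N. ln (g N) / ln N) \<longlongrightarrow> r) at_top"
proof -
  have lim: "((\<lambda>N. ln c / ln N + r) \<longlongrightarrow> r) at_top" for c :: real
    using tendsto_add[OF tendsto_divide_0[OF tendsto_const filterlim_at_top_imp_at_infinity[OF ln_at_top]] tendsto_const, of "ln c" r]
    by simp
  have split: "ln (c * N powr r) / ln N = ln c / ln N + r" if "c > 0" "N > 1" for c N :: real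
    using that by (simp add: ln_mult ln_powr add_divide_distrib)
  have "\<forall>\<^sub>F N in at_top. ln a / ln N + r \<le> ln (g N) / ln N \<and> ln (g N) / ln N \<le> ln b / ln N + r"
    using assms(2,3) eventually_gt_at_top[of 1]
  proof eventually_elim
    case (elim N)
    have pos: "0 < a * N powr r" using elim assms by simp
    then have "0 < b * N powr r" using elim by linarith
    then have "b > 0" using elim by (simp add: zero_less_mult_iff)
    have "ln (a * N powr r) \<le> ln (g N)" "ln (g N) \<le> ln (b * N powr r)"
      using elim pos by auto
    then have "ln (a * N powr r) / ln N \<le> ln (g N) / ln N" "ln (g N) / ln N \<le> ln (b * N powr r) / ln N"
      using elim by (auto intro!: divide_right_mono)
    then show ?case
      using elim assms \<open>b > 0\<close> by (simp add: split)
  qed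
  then show ?thesis
    by (intro tendsto_sandwich[OF _ _ lim[of a] lim[of b]]) (auto elim: eventually_mono)
qed

section \<open>Scaling exponents of power-law spectra\<close>

lemma spectral_mass_power_law:
  assumes "\<And>m. norm (u (m *s xi1) t) = c * \<bar>of_int m\<bar> powr (- \<alpha>)"
  shows "spectral_mass u N t = c\<^sup>2 * power_sum (2 * \<alpha>) N"
proof -
  let ?A = "{m::int. \<bar>real_of_int m\<bar> \<le> N}"
  have "spectral_mass u N t = (\<Sum>\<^sub>\<infinity>m\<in>?A. (norm (plane_mean_coeff u N m t))\<^sup>2)"
    unfolding spectral_mass_def by (rule infsum_cong_neutral) (auto simp: plane_mean_coeff_eq)
  also have "\<dots> = (\<Sum>m\<in>?A. (norm (plane_mean_coeff u N m t))\<^sup>2)"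
    by (simp add: abs_le_interval)
  also have "\<dots> = (\<Sum>m\<in>?A. c\<^sup>2 * \<bar>of_int m\<bar> powr (- (2 * \<alpha>)))"
    by (intro sum.cong) (auto simp: plane_mean_coeff_eq assms power_mult_distrib power2_eq_square simp flip: powr_add)
  finally show ?thesis
    by (simp add: power_sum_def sum_distrib_left)
qed

lemma renyi_sum_power_law:
  assumes "c > 0" and "\<And>m. norm (u (m *s xi1) t) = c * \<bar>of_int m\<bar> powr (- \<alpha>)"
  shows "(\<Sum>m | \<bar>real_of_int m\<bar> \<le> N. spectral_measure u N m t powr q) =
    power_sum (2 * \<alpha> * q) N / power_sum (2 * \<alpha>) N powr q"
proof -
  have nonneg: "power_sum (2 * \<alpha>) N \<ge> 0" unfolding power_sum_def by (intro sum_nonneg) auto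
  have "(\<Sum>m | \<bar>real_of_int m\<bar> \<le> N. spectral_measure u N m t powr q) =
      (\<Sum>m | \<bar>real_of_int m\<bar> \<le> N. \<bar>of_int m\<bar> powr (- (2 * \<alpha> * q)) / power_sum (2 * \<alpha>) N powr q)"
  proof (intro sum.cong refl)
    fix m :: int assume "m \<in> {m. \<bar>real_of_int m\<bar> \<le> N}"
    then have "(norm (plane_mean_coeff u N m t))\<^sup>2 = c\<^sup>2 * \<bar>of_int m\<bar> powr (- (2 * \<alpha>))"
      by (auto simp: plane_mean_coeff_eq assms power_mult_distrib power2_eq_square simp flip: powr_add)
    then have "spectral_measure u N m t = \<bar>of_int m\<bar> powr (- (2 * \<alpha>)) / power_sum (2 * \<alpha>) N"
      using \<open>c > 0\<close> by (simp add: spectral_measure_def spectral_mass_power_law[where u = u, OF assms(2)])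
    then show "spectral_measure u N m t powr q =
        \<bar>of_int m\<bar> powr (- (2 * \<alpha> * q)) / power_sum (2 * \<alpha>) N powr q"
      using nonneg by (simp add: powr_divide powr_powr)
  qed
  then show ?thesis by (simp add: power_sum_def sum_divide_distrib)
qed

lemma scaling_exponent_power_law:
  assumes \<alpha>: "0 < \<alpha>" "\<alpha> < 1 / 2" and q: "q > 1 / (2 * \<alpha>)" and "c > 0"
    and u: "\<And>m. norm (u (m *s xi1) t) = c * \<bar>of_int m\<bar> powr (- \<alpha>)"
  shows "has_scaling_exponent u q t ((1 - 2 * \<alpha>) * (q / (q - 1)))"
proof -
  have s: "2 * \<alpha> * q > 1" using q \<alpha> by (simp add: field_simps)
  have "1 / (2 * \<alpha>) > 1" using \<alpha> by (simp add: field_simps)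
  with q have q1: "q > 1" by linarith
  have pos: "power_sum (2 * \<alpha>) N > 0" if "N \<ge> 1" for N
    using power_sum_lower[of "2 * \<alpha>" N] \<alpha> that less_le_trans[of 0 "N powr (1 - 2 * \<alpha>)"] by simp
  have "\<forall>\<^sub>F N in at_top. spectral_mass u N t \<noteq> 0"
    using eventually_ge_at_top[of 1]
  proof eventually_elim
    case (elim N)
    then show ?case
      using \<open>c > 0\<close> pos[of N] by (simp add: spectral_mass_power_law[where u = u, OF u])
  qed
  moreover have "((\<lambda>N. renyi_entropy u q N t / ln N) \<longlongrightarrow> (1 - 2 * \<alpha>) * (q / (q - 1))) at_top"
  proof -
    have sub: "((\<lambda>N. ln (power_sum (2 * \<alpha>) N) / ln N) \<longlongrightarrow> 1 - 2 * \<alpha>) at_top"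
      using \<alpha> power_sum_lower[of "2 * \<alpha>"] power_sum_upper_subcritical[of "2 * \<alpha>"]
      by (intro growth_exponent[where a = 1 and b = "2 / (1 - 2 * \<alpha>)"]
          eventually_mono[OF eventually_ge_at_top[of 1]]) auto
    have sup: "((\<lambda>N. ln (power_sum (2 * \<alpha> * q) N) / ln N) \<longlongrightarrow> 0) at_top"
      using power_sum_bounds_supercritical[OF s]
      by (intro growth_exponent[where a = 1 and b = "2 * (\<Sum>k. real k powr (- (2 * \<alpha> * q)))"]
          eventually_mono[OF eventually_ge_at_top[of 1]]) auto
    have "((\<lambda>N. 1 / (1 - q) * (ln (power_sum (2 * \<alpha> * q) N) / ln N - q * (ln (power_sum (2 * \<alpha>) N) / ln N)))
        \<longlongrightarrow> 1 / (1 - q) * (0 - q * (1 - 2 * \<alpha>))) at_top"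
      by (intro tendsto_intros sub sup)
    moreover have "1 / (1 - q) * (0 - q * (1 - 2 * \<alpha>)) = (1 - 2 * \<alpha>) * (q / (q - 1))"
      using q1 by (simp add: field_simps)
    ultimately have "((\<lambda>N. 1 / (1 - q) * (ln (power_sum (2 * \<alpha> * q) N) / ln N - q * (ln (power_sum (2 * \<alpha>) N) / ln N)))
        \<longlongrightarrow> (1 - 2 * \<alpha>) * (q / (q - 1))) at_top"
      by (simp only:)
    moreover have "\<forall>\<^sub>F N in at_top. 1 / (1 - q) *
        (ln (power_sum (2 * \<alpha> * q) N) / ln N - q * (ln (power_sum (2 * \<alpha>) N) / ln N)) =
        renyi_entropy u q N t / ln N"
      using eventually_ge_at_top[of 1]
    proof eventually_elim
      case (elim N)
      have "power_sum (2 * \<alpha> * q) N > 0"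
        using power_sum_bounds_supercritical(1)[OF s elim] by linarith
      then show ?case
        using pos[OF elim]
        by (simp add: renyi_entropy_def renyi_sum_power_law[where u = u, OF \<open>c > 0\<close> u] ln_div ln_powr diff_divide_distrib
            mult.commute[of "ln N"])
    qed
    ultimately show ?thesis
      by (rule Lim_transform_eventually)
  qed
  ultimately show ?thesis
    using q1 by (simp add: has_scaling_exponent_def)
qed

section \<open>Cascade from a single shear mode\<close>

theorem corollary2p1:
  fixes \<alpha> :: real and f1 :: "int^3 \<Rightarrow> real"
  assumes "0 < \<alpha>" and "\<alpha> < 1 / 2"
    and "\<And>\<xi>. 0 \<le> f1 \<xi>"
  shows "\<exists>(u0 :: int^3 \<Rightarrow> complex^3) (u :: int^3 \<Rightarrow> real \<Rightarrow> complex^3) (T0 :: real).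
     euler_solution u0 u \<and> real_solution u \<and> 0 < T0 \<and>
     (\<forall>\<xi>. 1 < znorm \<xi> \<longrightarrow> norm (u0 \<xi>) \<le> f1 \<xi>) \<and>
     (\<forall>\<xi>. smooth_on (u \<xi>) {0..}) \<and>
     (\<forall>m::int. m \<noteq> 0 \<longrightarrow> norm (u (m *s xi1) T0) = znorm (m *s xi1) powr (- \<alpha>)) \<and>
     (\<forall>t>T0. \<forall>q>1 / (2 * \<alpha>).
        has_scaling_exponent u q t ((1 - 2 * \<alpha>) * (q / (q - 1))))"
proof (intro exI conjI allI impI)
  show "euler_solution background (cascade_flow \<alpha>)"
    by (rule cascade_flow_solves_euler)
  show "real_solution (cascade_flow \<alpha>)"
    by (rule cascade_flow_real)
  show "(0::real) < 1" by simp
  show "norm (background \<xi>) \<le> f1 \<xi>" if "1 < znorm \<xi>" for \<xi>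
    using that assms(3) by (auto simp: background_def znorm_e3)
  show "smooth_on (cascade_flow \<alpha> \<xi>) {0..}" for \<xi>
    unfolding cascade_flow_def[abs_def] by (rule smooth_on_affine_flat)
  show "norm (cascade_flow \<alpha> (m *s xi1) 1) = znorm (m *s xi1) powr (- \<alpha>)" for m
    by (simp add: norm_cascade_flow_axis znorm_axis flat_def)
  show "has_scaling_exponent (cascade_flow \<alpha>) q t ((1 - 2 * \<alpha>) * (q / (q - 1)))"
    if "1 < t" "1 / (2 * \<alpha>) < q" for t q
    using that assms(1,2)
    by (intro scaling_exponent_power_law[where c = "flat 1 t"] norm_cascade_flow_axis)
      (auto simp: flat_def)
qed

end
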